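(* The iterates generated by the algorithm (described in the context) satisfy, for every $T\ge1$, $$\sum_{t=1}^T\mathbb{E}\big[\|\boldsymbol m_t-\tilde{\boldsymbol m}_t\|^2\big]\le4\sum_{t=1}^T\mathbb{E}\big[\|\boldsymbol s_t-\tilde{\boldsymbol s}_t\|^2\big].$$
   Context: Problem. Let $n,d\ge1$. Nodes $\mathcal{V}=\{1,\dots,n\}$ communicate over an undirected graph $\mathcal{G}=(\mathcal{V},\mathcal{E},A)$ with weighted adjacency matrix $A=[A_{ij}]\in\mathbb{R}^{n\times n}$. Node $i$ has local cost $f_i(x)=\mathbb{E}_{\xi_i}[F_i(x,\xi_i)]$, $x\in\mathbb{R}^d$, where $\xi_i$ is a random variable. $\nabla F_i(x,\xi_i)$ is the gradient in $x$. $\odot$ is the entrywise product, $\otimes$ the Kronecker product, $\mathbf{1}_n$ the all-ones vector, $\|\cdot\|$ the Euclidean norm. Algorithm (GT-based distributed adaptive gradient algorithm). Parameters: $\beta_1,\beta_2\in(0,1)$, $\alpha>0$, $v_{\max}\ge1\ge v_{\min}>0$. Write $g_{t,i}=\nabla F_i(x_{t,i},\xi_{t,i})$, where $\xi_{t,i}$ is the sample of $\xi_i$ drawn at iteration $t$. Initialization: arbitrary $x_{1,i}\in\mathbb{R}^d$, $s_{1,i}=g_{1,i}$, $m_{1,i}=0$, $v_{1,i}=s_{1,i}\odot s_{1,i}$. For $t\ge1$ and every $i$: $m_{t+1,i}=\beta_1m_{t,i}+(1-\beta_1)s_{t,i}$; $\hat v_{t+1,i}=\beta_2v_{t,i}+(1-\beta_2)s_{t,i}\odot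 s_{t,i}$; $v_{t+1,i}=\max\{\min\{\hat v_{t+1,i},v_{\max}\},v_{\min}\}$ (entrywise); $V_{t+1,i}=\mathrm{diag}\{[v_{t+1,i}]_1,\dots,[v_{t+1,i}]_d\}$; $x_{t+1,i}=\sum_{j=1}^nA_{ij}x_{t,j}-\alpha V_{t+1,i}^{-1/2}m_{t+1,i}$; $s_{t+1,i}=\sum_{j=1}^nA_{ij}s_{t,j}+g_{t+1,i}-g_{t,i}$. Notation. For $\zeta\in\{m,s\}$: $\boldsymbol\zeta_t=[\zeta_{t,1}',\dots,\zeta_{t,n}']'\in\mathbb{R}^{nd}$, $\bar\zeta_t=\frac1n\sum_i\zeta_{t,i}$, $\tilde{\boldsymbol\zeta}_t=\mathbf{1}_n\otimes\bar\zeta_t$. *)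

theory Defs
  imports "HOL-Probability.Probability"
begin

text \<open>
  Nodes are the elements of a finite type \<open>'n\<close>, and \<open>real ^ 'd\<close> is the decision space.
  The diagonal of the weight matrix is unconstrained: a node may weight its own state
  whether or not self-loops are listed as edges. No sign or stochasticity condition is imposed.
\<close>

definition weighted_undirected_graph :: "('n::finite \<times> 'n) set \<Rightarrow> real ^ 'n ^ 'n \<Rightarrow> bool" where
  "weighted_undirected_graph E A \<longleftrightarrow>
     sym E \<and> transpose A = A \<and> (\<forall>i j. i \<noteq> j \<longrightarrow> ((i, j) \<in> E \<longleftrightarrow> A $ i $ j \<noteq> 0))"

definition grad :: "('a::real_inner \<Rightarrow> real) \<Rightarrow> 'a \<Rightarrow> 'a" where
  "grad f x = (THE D. GDERIV f x :> D)"

definition diag_mat :: "real ^ 'd \<Rightarrow> real ^ 'd ^ 'd" where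
  "diag_mat v = (\<chi> k l. if k = l then v $ k else 0)"

text \<open>Real powers of a diagonal matrix with positive diagonal.\<close>

definition diag_powr :: "real ^ 'd ^ 'd \<Rightarrow> real \<Rightarrow> real ^ 'd ^ 'd" where
  "diag_powr V p = (\<chi> k l. if k = l then (V $ k $ k) powr p else 0)"

definition clip :: "real \<Rightarrow> real \<Rightarrow> real ^ 'd \<Rightarrow> real ^ 'd" where
  "clip lo hi w = (\<chi> k. max (min (w $ k) hi) lo)"

text \<open>
  One realization of the algorithm. Here \<open>G i y z\<close> is the stochastic gradient of node \<open>i\<close> at
  the point \<open>y\<close> for the sample \<open>z\<close>, and \<open>\<xi> t i\<close> is the sample drawn by node \<open>i\<close> at iteration \<open>t\<close>.
  Iterations are counted from 1; values at index 0 are irrelevant. On \<open>real ^ 'd\<close> the product \<open>*\<close>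
  is the entrywise one.
\<close>

definition gt_adaptive_iterates ::
  "real ^ 'n ^ 'n \<Rightarrow> ('n::finite \<Rightarrow> real ^ 'd \<Rightarrow> 'c \<Rightarrow> real ^ 'd) \<Rightarrow>
   real \<Rightarrow> real \<Rightarrow> real \<Rightarrow> real \<Rightarrow> real \<Rightarrow> ('n \<Rightarrow> real ^ 'd) \<Rightarrow>
   (nat \<Rightarrow> 'n \<Rightarrow> 'c) \<Rightarrow>
   (nat \<Rightarrow> 'n \<Rightarrow> real ^ 'd) \<Rightarrow> (nat \<Rightarrow> 'n \<Rightarrow> real ^ 'd) \<Rightarrow>
   (nat \<Rightarrow> 'n \<Rightarrow> real ^ 'd) \<Rightarrow> (nat \<Rightarrow> 'n \<Rightarrow> real ^ 'd) \<Rightarrow> bool" where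
  "gt_adaptive_iterates A G \<beta>1 \<beta>2 \<alpha> vmin vmax x1 \<xi> x s m v \<longleftrightarrow>
     (let g = (\<lambda>t i. G i (x t i) (\<xi> t i)) in
       (\<forall>i. x 1 i = x1 i \<and> s 1 i = g 1 i \<and> m 1 i = 0 \<and> v 1 i = s 1 i * s 1 i) \<and>
       (\<forall>t\<ge>1. \<forall>i.
          m (t + 1) i = \<beta>1 *\<^sub>R m t i + (1 - \<beta>1) *\<^sub>R s t i \<and>
          v (t + 1) i = clip vmin vmax (\<beta>2 *\<^sub>R v t i + (1 - \<beta>2) *\<^sub>R (s t i * s t i)) \<and>
          x (t + 1) i = (\<Sum>j\<in>UNIV. A $ i $ j *\<^sub>R x t j)
             - \<alpha> *\<^sub>R (diag_powr (diag_mat (v (t + 1) i)) (- 1 / 2) *v m (t + 1) i) \<and>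
          s (t + 1) i = (\<Sum>j\<in>UNIV. A $ i $ j *\<^sub>R s t j) + g (t + 1) i - g t i))"

text \<open>Vectors of dimension \<open>n d\<close> are indexed by \<open>'n \<times> 'd\<close>, with the node as outer index.\<close>

definition stack :: "('n::finite \<Rightarrow> real ^ 'd) \<Rightarrow> real ^ ('n \<times> 'd)" where
  "stack z = (\<chi> p. z (fst p) $ snd p)"

definition node_avg :: "('n::finite \<Rightarrow> real ^ 'd) \<Rightarrow> real ^ 'd" where
  "node_avg z = (1 / real CARD('n)) *\<^sub>R (\<Sum>i\<in>UNIV. z i)"

definition kron_vec :: "real ^ 'n \<Rightarrow> real ^ 'd \<Rightarrow> real ^ ('n::finite \<times> 'd)" where
  "kron_vec u w = (\<chi> p. u $ fst p * w $ snd p)"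

text \<open>The numeral \<open>1\<close> of type \<open>real ^ 'n\<close> is the all-ones vector.\<close>

definition stack_avg :: "('n::finite \<Rightarrow> real ^ 'd) \<Rightarrow> real ^ ('n \<times> 'd)" where
  "stack_avg z = kron_vec (1 :: real ^ 'n) (node_avg z)"

text \<open>
  Expectation of a nonnegative random variable as an extended real. The Bochner integral would
  silently return 0 for a variable with infinite mean; here such a mean is \<open>\<infinity>\<close>, so no moment
  condition on the gradients is needed.
\<close>

definition nn_expectation :: "'w measure \<Rightarrow> ('w \<Rightarrow> real) \<Rightarrow> ennreal" where
  "nn_expectation M X = (\<integral>\<^sup>+\<omega>. ennreal (X \<omega>) \<partial>M)"

end

theory Submission
  imports Defs
begin

text \<open>
  The consensus error is linear, so that of \<open>m\<close> is the exponential average of the errors of \<open>s\<close>,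
  started at 0. By convexity of the squared norm, \<open>b (t + 1) \<le> \<beta>1 * b t + (1 - \<beta>1) * c t\<close> for the
  squared errors \<open>b\<close>, \<open>c\<close> of \<open>m\<close>, \<open>s\<close>, and summation gives the inequality pathwise, even with
  constant 1 in place of 4. To integrate term by term the iterates must be measurable; the
  stochastic gradients are, since a Caratheodory function is measurable along measurable arguments and
  partial derivatives are limits of difference quotients.
\<close>

section \<open>Measurability of stochastic gradients\<close>

text \<open>The map \<open>X\<close> is a pointwise limit of simple functions \<open>Y k\<close>.
  Continuity in the first argument carries measurability over from the composites with
  \<open>Y k\<close> to the composite with \<open>X\<close>.\<close>

lemma borel_measurable_caratheodory_compose:
  fixes h :: "'a::{metric_space, second_countable_topology} \<Rightarrow> 'c \<Rightarrow> 'b::metric_space"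
  assumes meas: "\<And>y. h y \<in> borel_measurable N"
    and cont: "\<And>y z. z \<in> space N \<Longrightarrow> isCont (\<lambda>u. h u z) y"
    and X: "X \<in> borel_measurable M" and Z: "Z \<in> measurable M N"
  shows "(\<lambda>\<omega>. h (X \<omega>) (Z \<omega>)) \<in> borel_measurable M"
proof -
  obtain Y where Y: "\<And>k. simple_function M (Y k)"
    and lim: "\<And>\<omega>. \<omega> \<in> space M \<Longrightarrow> (\<lambda>k. Y k \<omega>) \<longlonglongrightarrow> X \<omega>"
    using borel_measurable_implies_sequence_metric[OF X] by metis
  show ?thesis
  proof (rule borel_measurable_LIMSEQ_metric)
    fix k
    \<comment> \<open>\<open>Y k\<close> has finitely many values. On each of its level sets the
      composite agrees with some \<open>h y\<close> along \<open>Z\<close>, and these pieces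
      glue.\<close>
    show "(\<lambda>\<omega>. h (Y k \<omega>) (Z \<omega>)) \<in> borel_measurable M"
    proof (rule measurable_compose_countable'[where I = "Y k ` space M"])
      show "(\<lambda>\<omega>. h y (Z \<omega>)) \<in> borel_measurable M" for y
        by (rule measurable_compose[OF Z meas])
      show "Y k \<in> measurable M (count_space (Y k ` space M))"
        using Y[of k] by (auto simp: simple_function_def measurable_count_space_eq2)
      show "countable (Y k ` space M)"
        using Y[of k] by (simp add: simple_function_def countable_finite)
    qed
  next
    fix \<omega> assume "\<omega> \<in> space M"
    then show "(\<lambda>k. h (Y k \<omega>) (Z \<omega>)) \<longlonglongrightarrow> h (X \<omega>) (Z \<omega>)"
      using isCont_tendsto_compose[OF cont[OF measurable_space[OF Z]] lim] by simp
  qed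
qed

text \<open>Since \<open>grad\<close> is a definite description, both existence and uniqueness have
  to be shown. Existence is the Riesz representation of the derivative; uniqueness follows from
  uniqueness of the derivative.\<close>

lemma GDERIV_grad:
  fixes h :: "'a::euclidean_space \<Rightarrow> real"
  assumes "h differentiable (at y)"
  shows "GDERIV h y :> grad h y"
proof -
  obtain h' where h': "(h has_derivative h') (at y)"
    using assms by (auto simp: differentiable_def)
  interpret h': bounded_linear h'
    using h' by (rule has_derivative_bounded_linear)
  \<comment> \<open>The Riesz representative of \<open>h'\<close>, written out in the orthonormal
    basis.\<close>
  define D where "D = (\<Sum>b\<in>Basis. h' b *\<^sub>R b)"
  have "h' = (\<lambda>u. u \<bullet> D)"
  proof
    fix u
    have "h' u = h' (\<Sum>b\<in>Basis. (u \<bullet> b) *\<^sub>R b)"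
      by (simp add: euclidean_representation)
    then show "h' u = u \<bullet> D"
      by (simp add: h'.sum h'.scaleR D_def inner_sum_right mult.commute)
  qed
  with h' have D: "GDERIV h y :> D"
    by (simp add: gderiv_def)
  have "D' = D" if "GDERIV h y :> D'" for D'
  proof -
    have "(\<lambda>u. u \<bullet> D') = (\<lambda>u. u \<bullet> D)"
      using that D unfolding gderiv_def by (rule has_derivative_unique)
    then show ?thesis
      by (metis vector_eq_ldot)
  qed
  with D show ?thesis
    unfolding grad_def by (rule theI)
qed

text \<open>This is the directional derivative along the step sizes \<open>1 / (n + 1)\<close>. A
  sequence replaces the continuous limit because measurability passes to limits of
  sequences.\<close>

lemma grad_inner_LIMSEQ:
  fixes h :: "'a::euclidean_space \<Rightarrow> real"
  assumes "h differentiable (at y)"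
  shows "(\<lambda>n. (h (y + inverse (real (Suc n)) *\<^sub>R b) - h y) / inverse (real (Suc n)))
    \<longlonglongrightarrow> grad h y \<bullet> b"
proof -
  \<comment> \<open>The base point is written as the value at 0 of the line
    \<open>y + r *\<^sub>R b\<close>, the form that the chain rule expects.\<close>
  have "(h has_derivative (\<lambda>u. u \<bullet> grad h y)) (at (y + 0 *\<^sub>R b))"
    using GDERIV_grad[OF assms] by (simp add: gderiv_def)
  moreover have "((\<lambda>r. y + r *\<^sub>R b) has_derivative (\<lambda>r. r *\<^sub>R b)) (at (0::real))"
    by (auto intro!: derivative_eq_intros)
  ultimately have "((\<lambda>r. h (y + r *\<^sub>R b)) has_derivative (\<lambda>r. (r *\<^sub>R b) \<bullet> grad h y)) (at 0)"
    by (rule has_derivative_compose[rotated])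
  then have "DERIV (\<lambda>r. h (y + r *\<^sub>R b)) 0 :> grad h y \<bullet> b"
    by (simp add: has_field_derivative_def inner_commute mult_commute_abs)
  then have "(\<lambda>r. (h (y + r *\<^sub>R b) - h y) / r) \<midarrow>0\<rightarrow> grad h y \<bullet> b"
    by (simp add: DERIV_def)
  moreover have "filterlim (\<lambda>n. inverse (real (Suc n))) (at 0) sequentially"
    unfolding filterlim_at using LIMSEQ_inverse_real_of_nat by simp
  ultimately show ?thesis
    by (rule filterlim_compose)
qed

text \<open>Differentiability implies continuity in the point, so the Caratheodory argument makes
  every difference quotient measurable; the components of the gradient are their limits.\<close>

lemma borel_measurable_grad_compose:
  fixes h :: "'a::euclidean_space \<Rightarrow> 'c \<Rightarrow> real"
  assumes meas: "\<And>y. h y \<in> borel_measurable N"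
    and diff: "\<And>y z. z \<in> space N \<Longrightarrow> (\<lambda>u. h u z) differentiable (at y)"
    and X: "X \<in> borel_measurable M" and Z: "Z \<in> measurable M N"
  shows "(\<lambda>\<omega>. grad (\<lambda>u. h u (Z \<omega>)) (X \<omega>)) \<in> borel_measurable M"
proof -
  have cont: "isCont (\<lambda>u. h u z) y" if "z \<in> space N" for y z
    using diff[OF that] by (rule differentiable_imp_continuous_within)
  note comp = borel_measurable_caratheodory_compose[OF meas cont _ Z]
  have "(\<lambda>\<omega>. grad (\<lambda>u. h u (Z \<omega>)) (X \<omega>) \<bullet> b) \<in> borel_measurable M" for b
  proof (rule borel_measurable_LIMSEQ_real)
    fix \<omega> assume "\<omega> \<in> space M"
    then show "(\<lambda>n. (h (X \<omega> + inverse (real (Suc n)) *\<^sub>R b) (Z \<omega>) - h (X \<omega>) (Z \<omega>))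
        / inverse (real (Suc n))) \<longlonglongrightarrow> grad (\<lambda>u. h u (Z \<omega>)) (X \<omega>) \<bullet> b"
      by (intro grad_inner_LIMSEQ diff measurable_space[OF Z])
  next
    fix n
    show "(\<lambda>\<omega>. (h (X \<omega> + inverse (real (Suc n)) *\<^sub>R b) (Z \<omega>) - h (X \<omega>) (Z \<omega>))
        / inverse (real (Suc n))) \<in> borel_measurable M"
      by (intro borel_measurable_divide borel_measurable_diff comp borel_measurable_add X
          borel_measurable_const)
  qed
  then show ?thesis
    by (subst borel_measurable_euclidean_space) simp
qed

section \<open>Measurability of the iterates\<close>

lemma borel_measurable_vec_nth:
  fixes X :: "'w \<Rightarrow> real ^ 'k"
  assumes "X \<in> borel_measurable M"
  shows "(\<lambda>\<omega>. X \<omega> $ k) \<in> borel_measurable M"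
  using assms by (simp add: cart_eq_inner_axis)

lemma borel_measurable_vecI:
  fixes X :: "'w \<Rightarrow> real ^ 'k"
  assumes "\<And>k. (\<lambda>\<omega>. X \<omega> $ k) \<in> borel_measurable M"
  shows "X \<in> borel_measurable M"
  using assms
  by (subst borel_measurable_euclidean_space) (auto simp: Basis_vec_def cart_eq_inner_axis)

lemma borel_measurable_clip:
  assumes "X \<in> borel_measurable M"
  shows "(\<lambda>\<omega>. clip lo hi (X \<omega>)) \<in> borel_measurable M"
  by (rule borel_measurable_vecI, unfold clip_def vec_lambda_beta,
      intro borel_measurable_max borel_measurable_min borel_measurable_vec_nth assms
        borel_measurable_const)

lemma borel_measurable_vec_times:
  fixes X Y :: "'w \<Rightarrow> real ^ 'k"
  assumes "X \<in> borel_measurable M" "Y \<in> borel_measurable M"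
  shows "(\<lambda>\<omega>. X \<omega> * Y \<omega>) \<in> borel_measurable M"
  by (rule borel_measurable_vecI, unfold vector_mult_component,
      intro borel_measurable_times borel_measurable_vec_nth assms)

text \<open>Only the diagonal entry survives in each row. The preconditioned direction thus becomes
  a coordinatewise scalar expression, whose measurability is standard.\<close>

lemma diag_powr_mult_nth: "(diag_powr (diag_mat v) p *v w) $ k = (v $ k) powr p * w $ k"
  by (simp add: diag_powr_def diag_mat_def matrix_vector_mult_def if_distrib[where f = "\<lambda>a. a * _"]
      cong: if_cong)

lemma borel_measurable_diag_powr_mult:
  assumes "X \<in> borel_measurable M" "Y \<in> borel_measurable M"
  shows "(\<lambda>\<omega>. diag_powr (diag_mat (X \<omega>)) p *v Y \<omega>) \<in> borel_measurable M"
  by (rule borel_measurable_vecI, unfold diag_powr_mult_nth,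
      intro borel_measurable_times powr_real_measurable borel_measurable_vec_nth assms
        borel_measurable_const)

text \<open>Induction along the algorithm, from iteration 1 because index 0 is unspecified. The
  recursion is known on \<open>space M\<close> only, hence each update is substituted by
  \<open>measurable_cong\<close>.\<close>

lemma gt_adaptive_iterates_measurable:
  fixes x s m v :: "nat \<Rightarrow> 'n::finite \<Rightarrow> 'w \<Rightarrow> real ^ 'd"
  assumes G: "\<And>t i X. 1 \<le> t \<Longrightarrow> X \<in> borel_measurable M \<Longrightarrow>
      (\<lambda>\<omega>. G i (X \<omega>) (\<xi> t i \<omega>)) \<in> borel_measurable M"
    and iter: "\<And>\<omega>. \<omega> \<in> space M \<Longrightarrow> gt_adaptive_iterates A G \<beta>1 \<beta>2 \<alpha> vmin vmax x1
        (\<lambda>t i. \<xi> t i \<omega>) (\<lambda>t i. x t i \<omega>) (\<lambda>t i. s t i \<omega>) (\<lambda>t i. m t i \<omega>) (\<lambda>t i. v t i \<omega>)"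
    and "1 \<le> t"
  shows "x t i \<in> borel_measurable M \<and> s t i \<in> borel_measurable M \<and>
    m t i \<in> borel_measurable M \<and> v t i \<in> borel_measurable M"
  using \<open>1 \<le> t\<close>
proof (induction t arbitrary: i rule: dec_induct)
  case base
  have x: "x 1 i \<in> borel_measurable M"
    by (subst measurable_cong[where g = "\<lambda>_. x1 i"])
      (use iter in \<open>auto simp: gt_adaptive_iterates_def Let_def\<close>)
  have s: "s 1 i \<in> borel_measurable M"
    by (subst measurable_cong[where g = "\<lambda>\<omega>. G i (x 1 i \<omega>) (\<xi> 1 i \<omega>)"])
      (use iter G[OF _ x] in \<open>auto simp: gt_adaptive_iterates_def Let_def\<close>)
  have m: "m 1 i \<in> borel_measurable M"
    by (subst measurable_cong[where g = "\<lambda>_. 0"])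
      (use iter in \<open>auto simp: gt_adaptive_iterates_def Let_def\<close>)
  have v: "v 1 i \<in> borel_measurable M"
    by (subst measurable_cong[where g = "\<lambda>\<omega>. s 1 i \<omega> * s 1 i \<omega>"])
      (use iter borel_measurable_vec_times[OF s s] in
        \<open>auto simp: gt_adaptive_iterates_def Let_def\<close>)
  from x s m v show ?case by simp
next
  case (step t)
  have t: "1 \<le> t" by fact
  have xt: "x t j \<in> borel_measurable M" and st: "s t j \<in> borel_measurable M"
    and mt: "m t j \<in> borel_measurable M" and vt: "v t j \<in> borel_measurable M" for j
    using step.IH by auto
  have rec: "m (Suc t) j \<omega> = \<beta>1 *\<^sub>R m t j \<omega> + (1 - \<beta>1) *\<^sub>R s t j \<omega>"
    "v (Suc t) j \<omega> = clip vmin vmax (\<beta>2 *\<^sub>R v t j \<omega> + (1 - \<beta>2) *\<^sub>R (s t j \<omega> * s t j \<omega>))"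
    "x (Suc t) j \<omega> = (\<Sum>k\<in>UNIV. A $ j $ k *\<^sub>R x t k \<omega>)
       - \<alpha> *\<^sub>R (diag_powr (diag_mat (v (Suc t) j \<omega>)) (- 1 / 2) *v m (Suc t) j \<omega>)"
    "s (Suc t) j \<omega> = (\<Sum>k\<in>UNIV. A $ j $ k *\<^sub>R s t k \<omega>)
       + G j (x (Suc t) j \<omega>) (\<xi> (Suc t) j \<omega>) - G j (x t j \<omega>) (\<xi> t j \<omega>)"
    if "\<omega> \<in> space M" for j \<omega>
    using iter[OF that] t by (simp_all add: gt_adaptive_iterates_def Let_def)
  \<comment> \<open>The order follows the data flow: \<open>x (Suc t)\<close> uses the new
    \<open>m\<close> and \<open>v\<close>, and \<open>s (Suc t)\<close> uses the gradient at the new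
    \<open>x\<close>.\<close>
  have m: "m (Suc t) i \<in> borel_measurable M"
    by (subst measurable_cong[OF rec(1)], assumption) (use mt st in measurable)
  have v: "v (Suc t) i \<in> borel_measurable M"
    by (subst measurable_cong[OF rec(2)], assumption)
      (intro borel_measurable_clip borel_measurable_add borel_measurable_scaleR
        borel_measurable_const borel_measurable_vec_times vt st)
  have x: "x (Suc t) i \<in> borel_measurable M"
    by (subst measurable_cong[OF rec(3)], assumption)
      (intro borel_measurable_diff borel_measurable_sum borel_measurable_scaleR
        borel_measurable_const borel_measurable_diag_powr_mult xt v m)
  have s: "s (Suc t) i \<in> borel_measurable M"
    by (subst measurable_cong[OF rec(4)], assumption)
      (intro borel_measurable_diff borel_measurable_add borel_measurable_sum
        borel_measurable_scaleR borel_measurable_const st G x xt t, simp)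
  from x s m v show ?case by simp
qed

section \<open>Consensus errors\<close>

lemma stack_diff_stack_avg_nth:
  "(stack z - stack_avg z) $ p = z (fst p) $ snd p - node_avg z $ snd p"
  by (simp add: stack_def stack_avg_def kron_vec_def)

lemma stack_diff_stack_avg_linear:
  "stack (\<lambda>i. a *\<^sub>R z i + b *\<^sub>R w i) - stack_avg (\<lambda>i. a *\<^sub>R z i + b *\<^sub>R w i) =
     a *\<^sub>R (stack z - stack_avg z) + b *\<^sub>R (stack w - stack_avg w)"
proof -
  have "node_avg (\<lambda>i. a *\<^sub>R z i + b *\<^sub>R w i) = a *\<^sub>R node_avg z + b *\<^sub>R node_avg w"
    by (simp add: node_avg_def sum.distrib scaleR_sum_right[symmetric] scaleR_add_right)
  then show ?thesis
    unfolding vec_eq_iff vector_add_component vector_scaleR_component stack_diff_stack_avg_nth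
    by (simp add: algebra_simps)
qed

lemma borel_measurable_stack_diff_stack_avg:
  fixes X :: "'n::finite \<Rightarrow> 'w \<Rightarrow> real ^ 'd"
  assumes "\<And>i. X i \<in> borel_measurable M"
  shows "(\<lambda>\<omega>. stack (\<lambda>i. X i \<omega>) - stack_avg (\<lambda>i. X i \<omega>)) \<in> borel_measurable M"
  by (rule borel_measurable_vecI, unfold stack_diff_stack_avg_nth node_avg_def,
      intro borel_measurable_diff borel_measurable_vec_nth borel_measurable_scaleR
        borel_measurable_const borel_measurable_sum assms)

text \<open>The triangle inequality reduces the claim to the norms, where the real square is
  convex.\<close>

lemma norm_convex_combination_power2_le:
  fixes y z :: "'a::real_normed_vector"
  assumes "0 \<le> \<beta>" "\<beta> \<le> 1"
  shows "(norm (\<beta> *\<^sub>R y + (1 - \<beta>) *\<^sub>R z))\<^sup>2 \<le> \<beta> * (norm y)\<^sup>2 + (1 - \<beta>) * (norm z)\<^sup>2"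
proof -
  have "norm (\<beta> *\<^sub>R y + (1 - \<beta>) *\<^sub>R z) \<le> \<beta> * norm y + (1 - \<beta>) * norm z"
    using norm_triangle_ineq[of "\<beta> *\<^sub>R y" "(1 - \<beta>) *\<^sub>R z"] assms by simp
  then have "(norm (\<beta> *\<^sub>R y + (1 - \<beta>) *\<^sub>R z))\<^sup>2 \<le> (\<beta> * norm y + (1 - \<beta>) * norm z)\<^sup>2"
    by (rule power_mono) simp
  \<comment> \<open>In \<open>convex_onD\<close> the weight belongs to the second point, hence
    \<open>1 - \<beta>\<close>.\<close>
  also have "\<dots> \<le> \<beta> * (norm y)\<^sup>2 + (1 - \<beta>) * (norm z)\<^sup>2"
    using convex_onD[OF convex_power2, of "1 - \<beta>" "norm y" "norm z"] assms by simp
  finally show ?thesis .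
qed

lemma sum_exponential_average_le:
  fixes b c :: "nat \<Rightarrow> real"
  assumes "\<beta> < 1" and b: "\<And>t. 0 \<le> b t" and "b 1 = 0"
    and step: "\<And>t. 1 \<le> t \<Longrightarrow> b (Suc t) \<le> \<beta> * b t + (1 - \<beta>) * c t"
  shows "(\<Sum>t=1..T. b t) \<le> (\<Sum>t=1..T. c t)"
proof -
  \<comment> \<open>Keeping the boundary term \<open>b (Suc T)\<close> makes the bound inductive:
    together with \<open>(1 - \<beta>) * b (Suc T)\<close>, the summand
    \<open>\<beta> * b (Suc T)\<close> from the recursion restores it. For \<open>T = 0\<close> the
    claim is \<open>b 1 \<le> 0\<close>.\<close>
  have "(1 - \<beta>) * (\<Sum>t=1..T. b t) + b (Suc T) \<le> (1 - \<beta>) * (\<Sum>t=1..T. c t)"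
  proof (induction T)
    case 0
    then show ?case using \<open>b 1 = 0\<close> by simp
  next
    case (Suc T)
    then show ?case using step[of "Suc T"] by (simp add: algebra_simps)
  qed
  then have "(1 - \<beta>) * (\<Sum>t=1..T. b t) \<le> (1 - \<beta>) * (\<Sum>t=1..T. c t)"
    using b[of "Suc T"] by linarith
  then show ?thesis
    using \<open>\<beta> < 1\<close> by simp
qed

theorem lemma2:
  fixes M :: "'w measure"
    and E :: "('n::finite \<times> 'n) set"
    and A :: "real ^ 'n ^ 'n"
    and D :: "'n \<Rightarrow> 'c measure"
    and F :: "'n \<Rightarrow> real ^ 'd \<Rightarrow> 'c \<Rightarrow> real"
    and f :: "'n \<Rightarrow> real ^ 'd \<Rightarrow> real"
    and \<xi> :: "nat \<Rightarrow> 'n \<Rightarrow> 'w \<Rightarrow> 'c"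
    and \<beta>1 \<beta>2 \<alpha> vmin vmax :: real
    and x1 :: "'n \<Rightarrow> real ^ 'd"
    and x s m v :: "nat \<Rightarrow> 'n \<Rightarrow> 'w \<Rightarrow> real ^ 'd"
    and T :: nat
  assumes "prob_space M"
    and "weighted_undirected_graph E A"
    and "\<And>i. prob_space (D i)"
    and "\<And>i y. has_bochner_integral (D i) (F i y) (f i y)"
    and "\<And>i y z. z \<in> space (D i) \<Longrightarrow> (\<lambda>u. F i u z) differentiable (at y)"
    and "\<And>t i. 1 \<le> t \<Longrightarrow> \<xi> t i \<in> measurable M (D i)"
    and "\<And>t i. 1 \<le> t \<Longrightarrow> distr M (D i) (\<xi> t i) = D i"
    and "0 < \<beta>1" "\<beta>1 < 1" "0 < \<beta>2" "\<beta>2 < 1" "0 < \<alpha>"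
    and "0 < vmin" "vmin \<le> 1" "1 \<le> vmax"
    and "\<And>\<omega>. \<omega> \<in> space M \<Longrightarrow>
      gt_adaptive_iterates A (\<lambda>i y z. grad (\<lambda>u. F i u z) y) \<beta>1 \<beta>2 \<alpha> vmin vmax x1
        (\<lambda>t i. \<xi> t i \<omega>) (\<lambda>t i. x t i \<omega>) (\<lambda>t i. s t i \<omega>) (\<lambda>t i. m t i \<omega>) (\<lambda>t i. v t i \<omega>)"
    and "1 \<le> T"
  shows "(\<Sum>t=1..T. nn_expectation M
            (\<lambda>\<omega>. (norm (stack (\<lambda>i. m t i \<omega>) - stack_avg (\<lambda>i. m t i \<omega>)))\<^sup>2))
       \<le> 4 * (\<Sum>t=1..T. nn_expectation M
            (\<lambda>\<omega>. (norm (stack (\<lambda>i. s t i \<omega>) - stack_avg (\<lambda>i. s t i \<omega>)))\<^sup>2))"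
proof -
  let ?e = "\<lambda>z t \<omega>. stack (\<lambda>i. z t i \<omega>) - stack_avg (\<lambda>i. z t i \<omega>)"
  note iter = assms(16)
  have F: "F i y \<in> borel_measurable (D i)" for i y
    using assms(4) by (rule borel_measurable_has_bochner_integral)
  have meas: "s t i \<in> borel_measurable M \<and> m t i \<in> borel_measurable M" if "1 \<le> t" for t i
    using gt_adaptive_iterates_measurable[OF
        borel_measurable_grad_compose[OF F assms(5) _ assms(6)] iter that] by blast
  have meas_e: "(\<lambda>\<omega>. ennreal ((norm (?e s t \<omega>))\<^sup>2)) \<in> borel_measurable M"
    "(\<lambda>\<omega>. ennreal ((norm (?e m t \<omega>))\<^sup>2)) \<in> borel_measurable M" if "t \<in> {1..T}" for t
    by (intro measurable_compose[OF _ measurable_ennreal] borel_measurable_power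
        measurable_compose[OF _ borel_measurable_norm] borel_measurable_stack_diff_stack_avg;
        use that meas in simp)+
  have path: "(\<Sum>t=1..T. (norm (?e m t \<omega>))\<^sup>2) \<le> (\<Sum>t=1..T. (norm (?e s t \<omega>))\<^sup>2)"
    if \<omega>: "\<omega> \<in> space M" for \<omega>
  proof (rule sum_exponential_average_le[OF \<open>\<beta>1 < 1\<close>])
    have "m 1 i \<omega> = 0" for i
      using iter[OF \<omega>] by (simp add: gt_adaptive_iterates_def Let_def)
    \<comment> \<open>Linearity with both coefficients 0 shows that the zero family has zero
      error.\<close>
    then show "(norm (?e m 1 \<omega>))\<^sup>2 = 0"
      using stack_diff_stack_avg_linear[of 0 "\<lambda>_. 0 :: real ^ 'd" 0 "\<lambda>_ :: 'n. 0"] by simp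
  next
    fix t :: nat assume "1 \<le> t"
    then have "m (Suc t) i \<omega> = \<beta>1 *\<^sub>R m t i \<omega> + (1 - \<beta>1) *\<^sub>R s t i \<omega>" for i
      using iter[OF \<omega>] by (simp add: gt_adaptive_iterates_def Let_def)
    \<comment> \<open>All nodes share the coefficients \<open>\<beta>1\<close> and
      \<open>1 - \<beta>1\<close>, so the update passes to the errors.\<close>
    then have "?e m (Suc t) \<omega> = \<beta>1 *\<^sub>R ?e m t \<omega> + (1 - \<beta>1) *\<^sub>R ?e s t \<omega>"
      by (simp only: stack_diff_stack_avg_linear)
    then show "(norm (?e m (Suc t) \<omega>))\<^sup>2 \<le>
        \<beta>1 * (norm (?e m t \<omega>))\<^sup>2 + (1 - \<beta>1) * (norm (?e s t \<omega>))\<^sup>2"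
      using norm_convex_combination_power2_le[of \<beta>1] \<open>0 < \<beta>1\<close> \<open>\<beta>1 < 1\<close> by simp
  qed simp
  \<comment> \<open>Exchanging sum and integral is the step that uses measurability; the pathwise
    bound is then integrated by monotonicity.\<close>
  have "(\<Sum>t=1..T. nn_expectation M (\<lambda>\<omega>. (norm (?e m t \<omega>))\<^sup>2)) =
      (\<integral>\<^sup>+\<omega>. (\<Sum>t=1..T. ennreal ((norm (?e m t \<omega>))\<^sup>2)) \<partial>M)"
    unfolding nn_expectation_def by (rule nn_integral_sum[symmetric]) (rule meas_e)
  also have "\<dots> \<le> (\<integral>\<^sup>+\<omega>. (\<Sum>t=1..T. ennreal ((norm (?e s t \<omega>))\<^sup>2)) \<partial>M)"
    by (rule nn_integral_mono) (simp add: sum_ennreal ennreal_leI path[simplified])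
  also have "\<dots> = (\<Sum>t=1..T. nn_expectation M (\<lambda>\<omega>. (norm (?e s t \<omega>))\<^sup>2))"
    unfolding nn_expectation_def by (rule nn_integral_sum) (rule meas_e)
  \<comment> \<open>Weakens the constant from 1 to 4; in \<open>ennreal\<close> this also covers an
    infinite sum.\<close>
  also have "\<dots> \<le> 4 * \<dots>"
    using mult_right_mono[of "1::ennreal" 4] by simp
  finally show ?thesis .
qed

end
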